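(* For $i=1,2$, let $\mathcal{C}_i$ be an $(n_i,\alpha_i,\theta_i,\rho_i)$-FR code, and suppose $\alpha_1/\theta_1=\alpha_2/\theta_2$. Then for every $k=1,2,\ldots,n_1+n_2$, $$N_k(\mathcal{C}_1\otimes\mathcal{C}_2)=\max_{\substack{x\in\{0,1,\ldots,n_1\}\\ y\in\{0,1,\ldots,n_2\}\\ x+y=k}}N_x(\mathcal{C}_1)\,N_y(\mathcal{C}_2).$$
   Context: An incidence structure is a triple $(P,\mathcal{B},\mathcal{I})$ with $P$ (points) and $\mathcal{B}$ (blocks) nonempty finite sets and $\mathcal{I}\subseteq P\times\mathcal{B}$; a point $p$ is incident with a block $B$ if $(p,B)\in\mathcal{I}$. Distinct blocks are allowed to be incident with the same set of points. For positive integers $n,\alpha,\theta,\rho$, an $(n,\alpha,\theta,\rho)$-FR (fractional repetition) code is an incidence structure with $|P|=\theta$, $|\mathcal{B}|=n$, every block incident with exactly $\alpha$ points, and every point incident with exactly $\rho$ blocks. For an FR code $\mathcal{C}=(P,\mathcal{B},\mathcal{I})$ and $1\le k\le|\mathcal{B}|$, the supported file size is $$M_k(\mathcal{C})=\min_{\mathcal{K}\subseteq\mathcal{B},\,|\mathcal{K}|=k}\bigl|\{p\in P:\exists B\in\mathcal{K},\ (p,B)\in\mathcal{I}\}\bigr|,$$ with $M_0(\mathcal{C})=0$, and $N_k(\mathcal{C})=|P|-M_k(\mathcal{C})$ for $0\le k\le|\mathcal{B}|$. Tensor product: let $\mathcal{C}$ be an $(n,\alpha,\theta,\rho)$-FR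 code with point set $P$ and blocks $B_1,\ldots,B_n$, and $\mathcal{C}'$ an $(n',\alpha',\theta',\rho')$-FR code with point set $P'$ and blocks $B'_1,\ldots,B'_{n'}$ (each block identified with its set of incident points, blocks being distinguished by their index), with $\alpha/\theta=\alpha'/\theta'$. Then $\mathcal{C}\otimes\mathcal{C}'$ is the FR code with point set $P\times P'$ and the $n+n'$ blocks $B_i\times P'$ ($1\le i\le n$) and $P\times B'_j$ ($1\le j\le n'$), these being regarded as $n+n'$ separate blocks. It has parameters $(n+n',\alpha\theta',\theta\theta',\rho+\rho')$. *)

theory Defs
  imports Complex_Main
begin

record ('p, 'b) incidence =
  points :: "'p set"
  blocks :: "'b set"
  inc :: "('p \<times> 'b) set"

text \<open>Blocks are abstract labels, so distinct blocks may be incident with the same set of points.\<close>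

definition incidence_structure :: "('p, 'b) incidence \<Rightarrow> bool" where
  "incidence_structure C \<longleftrightarrow>
     finite (points C) \<and> points C \<noteq> {} \<and>
     finite (blocks C) \<and> blocks C \<noteq> {} \<and>
     inc C \<subseteq> points C \<times> blocks C"

definition FR_code ::
  "nat \<Rightarrow> nat \<Rightarrow> nat \<Rightarrow> nat \<Rightarrow> ('p, 'b) incidence \<Rightarrow> bool" where
  "FR_code n \<alpha> \<theta> \<rho> C \<longleftrightarrow>
     0 < n \<and> 0 < \<alpha> \<and> 0 < \<theta> \<and> 0 < \<rho> \<and>
     incidence_structure C \<and>
     card (points C) = \<theta> \<and> card (blocks C) = n \<and>
     (\<forall>B\<in>blocks C. card {p \<in> points C. (p, B) \<in> inc C} = \<alpha>) \<and>
     (\<forall>p\<in>points C. card {B \<in> blocks C. (p, B) \<in> inc C} = \<rho>)"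

text \<open>Only meaningful for \<open>k \<le> card (blocks C)\<close>: otherwise \<open>Min\<close> is taken over the empty set.\<close>

definition supported_file_size :: "('p, 'b) incidence \<Rightarrow> nat \<Rightarrow> nat" where
  "supported_file_size C k =
     (if k = 0 then 0
      else Min ((\<lambda>K. card {p \<in> points C. \<exists>B\<in>K. (p, B) \<in> inc C}) `
             {K. K \<subseteq> blocks C \<and> card K = k}))"

text \<open>For \<open>k \<le> card (blocks C)\<close> the subtraction does not truncate, since the minimum is over
  cardinalities of subsets of the point set.\<close>

definition file_size_defect :: "('p, 'b) incidence \<Rightarrow> nat \<Rightarrow> nat" where
  "file_size_defect C k = card (points C) - supported_file_size C k"

text \<open>The disjoint sum of the two block sets keeps \<open>B \<times> P'\<close> and \<open>P \<times> B'\<close> separate even if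
  they coincide as sets of points.\<close>

definition tensor ::
  "('p, 'b) incidence \<Rightarrow> ('q, 'c) incidence \<Rightarrow> ('p \<times> 'q, 'b + 'c) incidence" where
  "tensor C D =
     \<lparr> points = points C \<times> points D,
       blocks = blocks C <+> blocks D,
       inc = {((p, q), Inl B) | p q B. (p, B) \<in> inc C \<and> q \<in> points D} \<union>
             {((p, q), Inr B) | p q B. p \<in> points C \<and> (q, B) \<in> inc D} \<rparr>"

text \<open>The equal-ratio hypothesis is what makes the tensor product an FR code.\<close>

lemma FR_code_tensor:
  assumes C: "FR_code n \<alpha> \<theta> \<rho> C" and D: "FR_code n' \<alpha>' \<theta>' \<rho>' D"
    and ratio: "real \<alpha> / real \<theta> = real \<alpha>' / real \<theta>'"
  shows "FR_code (n + n') (\<alpha> * \<theta>') (\<theta> * \<theta>') (\<rho> + \<rho>') (tensor C D)"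
proof -
  note defs = FR_code_def incidence_structure_def
  have pos: "0 < \<theta>" "0 < \<theta>'" using C D by (auto simp: FR_code_def)
  then have "real \<alpha> * real \<theta>' = real \<alpha>' * real \<theta>"
    using ratio by (simp add: field_simps)
  then have cross: "\<alpha> * \<theta>' = \<theta> * \<alpha>'"
    by (metis mult.commute of_nat_eq_iff of_nat_mult)
  have blk: "card {x \<in> points (tensor C D). (x, X) \<in> inc (tensor C D)} = \<alpha> * \<theta>'"
    if "X \<in> blocks (tensor C D)" for X
  proof (cases X)
    case (Inl B)
    then have "B \<in> blocks C" using that by (auto simp: tensor_def)
    moreover have "{x \<in> points (tensor C D). (x, X) \<in> inc (tensor C D)} =
        {p \<in> points C. (p, B) \<in> inc C} \<times> points D"
      using Inl by (auto simp: tensor_def)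
    ultimately show ?thesis using C D by (simp add: defs card_cartesian_product)
  next
    case (Inr B)
    then have "B \<in> blocks D" using that by (auto simp: tensor_def)
    moreover have "{x \<in> points (tensor C D). (x, X) \<in> inc (tensor C D)} =
        points C \<times> {p \<in> points D. (p, B) \<in> inc D}"
      using Inr by (auto simp: tensor_def)
    ultimately show ?thesis using C D cross by (simp add: defs card_cartesian_product)
  qed
  have pt: "card {X \<in> blocks (tensor C D). (x, X) \<in> inc (tensor C D)} = \<rho> + \<rho>'"
    if xmem: "x \<in> points (tensor C D)" for x
  proof -
    obtain p q where x: "x = (p, q)" "p \<in> points C" "q \<in> points D"
      using xmem by (cases x) (auto simp: tensor_def)
    have "{X \<in> blocks (tensor C D). (x, X) \<in> inc (tensor C D)} =
        {B \<in> blocks C. (p, B) \<in> inc C} <+> {B \<in> blocks D. (q, B) \<in> inc D}"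
      using x by (auto simp: tensor_def)
    then show ?thesis using C D x by (simp add: defs card_Plus)
  qed
  have "incidence_structure (tensor C D)"
    using C D by (auto simp: defs tensor_def)
  moreover have "card (points (tensor C D)) = \<theta> * \<theta>'" "card (blocks (tensor C D)) = n + n'"
    using C D by (simp_all add: defs tensor_def card_cartesian_product card_Plus)
  moreover have "0 < n + n'" "0 < \<alpha> * \<theta>'" "0 < \<theta> * \<theta>'" "0 < \<rho> + \<rho>'"
    using C D by (simp_all add: FR_code_def)
  ultimately show ?thesis using blk pt unfolding FR_code_def by blast
qed

end

theory Submission
  imports Defs
begin

text \<open>\<open>N\<^sub>k\<close> is the largest number of points missed by \<open>k\<close> blocks. A set of blocks of the tensor
  product is a disjoint sum of a set of blocks of each factor, and the points it misses are the
  product of the two sets of missed points.\<close>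

definition missed :: "('p, 'b) incidence \<Rightarrow> 'b set \<Rightarrow> 'p set" where
  "missed C K = {p \<in> points C. \<forall>B\<in>K. (p, B) \<notin> inc C}"

lemma card_missed:
  assumes "finite (points C)"
  shows "card (missed C K) = card (points C) - card {p \<in> points C. \<exists>B\<in>K. (p, B) \<in> inc C}"
proof -
  have "missed C K = points C - {p \<in> points C. \<exists>B\<in>K. (p, B) \<in> inc C}"
    by (auto simp: missed_def)
  then show ?thesis using assms by (simp add: card_Diff_subset)
qed

text \<open>Complementing in the point set turns the minimum of covered points into a maximum of
  missed points. This is the upper-bound half of that reading and
  \<open>file_size_defect_attained\<close> is the other; the tensor argument uses only these two
  facts and never \<open>Min\<close> itself.\<close>

lemma card_missed_le_file_size_defect:
  assumes "incidence_structure C" "K \<subseteq> blocks C"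
  shows "card (missed C K) \<le> file_size_defect C (card K)"
proof -
  have fin: "finite (points C)" "finite (blocks C)"
    using assms by (auto simp: incidence_structure_def)
  \<comment> \<open>\<open>K\<close> itself competes in the minimum; if \<open>card K = 0\<close>,
    the left side is 0 by convention.\<close>
  have "supported_file_size C (card K) \<le> card {p \<in> points C. \<exists>B\<in>K. (p, B) \<in> inc C}"
    unfolding supported_file_size_def using assms fin by (auto intro!: Min_le)
  then show ?thesis
    by (simp add: file_size_defect_def card_missed[OF fin(1)])
qed

text \<open>A minimum over a finite nonempty family is attained, and the bound on \<open>k\<close>
  makes the family of \<open>k\<close>-subsets nonempty.\<close>

lemma file_size_defect_attained:
  assumes "incidence_structure C" "k \<le> card (blocks C)"
  obtains K where "K \<subseteq> blocks C" "card K = k" "card (missed C K) = file_size_defect C k"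
proof (cases "k = 0")
  \<comment> \<open>The convention \<open>M_0 = 0\<close> matches the empty set of blocks, which
    misses every point.\<close>
  case True
  then show ?thesis
    using that[of "{}"] by (simp add: missed_def file_size_defect_def supported_file_size_def)
next
  case False
  let ?f = "\<lambda>K. card {p \<in> points C. \<exists>B\<in>K. (p, B) \<in> inc C}"
  let ?S = "{K. K \<subseteq> blocks C \<and> card K = k}"
  have fin: "finite (points C)" "finite (blocks C)"
    using assms by (auto simp: incidence_structure_def)
  have "?S \<noteq> {}" using obtain_subset_with_card_n[OF assms(2)] by blast
  then have "Min (?f ` ?S) \<in> ?f ` ?S" using fin by (intro Min_in) auto
  then obtain K where "K \<in> ?S" "?f K = Min (?f ` ?S)" by auto
  with False show ?thesis
    using that[of K]
    by (simp add: card_missed[OF fin(1)] file_size_defect_def supported_file_size_def)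
qed

lemma incidence_structure_tensor:
  assumes "incidence_structure C" "incidence_structure D"
  shows "incidence_structure (tensor C D)"
  using assms by (auto simp: incidence_structure_def tensor_def)

text \<open>On the product point set, a block \<open>Inl B\<close> tests only the first coordinate
  and \<open>Inr B\<close> only the second, so avoiding \<open>K <+> L\<close> splits into two
  independent conditions.\<close>

lemma missed_tensor:
  "missed (tensor C D) (K <+> L) = missed C K \<times> missed D L"
  by (auto simp: missed_def tensor_def Plus_def ball_Un)

theorem theorem9:
  fixes C\<^sub>1 :: "('p, 'b) incidence" and C\<^sub>2 :: "('q, 'c) incidence"
    and n\<^sub>1 \<alpha>\<^sub>1 \<theta>\<^sub>1 \<rho>\<^sub>1 n\<^sub>2 \<alpha>\<^sub>2 \<theta>\<^sub>2 \<rho>\<^sub>2 k :: nat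
  assumes "FR_code n\<^sub>1 \<alpha>\<^sub>1 \<theta>\<^sub>1 \<rho>\<^sub>1 C\<^sub>1" and "FR_code n\<^sub>2 \<alpha>\<^sub>2 \<theta>\<^sub>2 \<rho>\<^sub>2 C\<^sub>2"
    and "real \<alpha>\<^sub>1 / real \<theta>\<^sub>1 = real \<alpha>\<^sub>2 / real \<theta>\<^sub>2"
    and "k \<in> {1..n\<^sub>1 + n\<^sub>2}"
  shows "file_size_defect (tensor C\<^sub>1 C\<^sub>2) k =
    Max {file_size_defect C\<^sub>1 x * file_size_defect C\<^sub>2 y | x y.
           x \<in> {0..n\<^sub>1} \<and> y \<in> {0..n\<^sub>2} \<and> x + y = k}"
proof (rule Max_eqI[symmetric])
  have C: "incidence_structure C\<^sub>1" "card (blocks C\<^sub>1) = n\<^sub>1" "finite (blocks C\<^sub>1)"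
    and D: "incidence_structure C\<^sub>2" "card (blocks C\<^sub>2) = n\<^sub>2" "finite (blocks C\<^sub>2)"
    using assms(1,2) by (auto simp: FR_code_def incidence_structure_def)
  let ?T = "tensor C\<^sub>1 C\<^sub>2"
  let ?S = "{file_size_defect C\<^sub>1 x * file_size_defect C\<^sub>2 y | x y.
           x \<in> {0..n\<^sub>1} \<and> y \<in> {0..n\<^sub>2} \<and> x + y = k}"
  have T: "incidence_structure ?T"
    using C(1) D(1) by (rule incidence_structure_tensor)
  have blocks: "blocks ?T = blocks C\<^sub>1 <+> blocks C\<^sub>2"
    by (simp add: tensor_def)
  have "?S \<subseteq> (\<lambda>(x, y). file_size_defect C\<^sub>1 x * file_size_defect C\<^sub>2 y) ` ({0..n\<^sub>1} \<times> {0..n\<^sub>2})"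
    by auto
  then show "finite ?S" by (rule finite_subset) simp
  \<comment> \<open>Optimal block sets of sizes \<open>x\<close> and \<open>y\<close> in the factors
    combine to \<open>k\<close> blocks of the product that miss exactly \<open>m\<close>
    points.\<close>
  show le: "m \<le> file_size_defect ?T k" if m: "m \<in> ?S" for m
  proof -
    obtain x y where xy: "m = file_size_defect C\<^sub>1 x * file_size_defect C\<^sub>2 y"
      "x \<le> n\<^sub>1" "y \<le> n\<^sub>2" "x + y = k"
      using m by auto
    obtain K where K: "K \<subseteq> blocks C\<^sub>1" "card K = x" "card (missed C\<^sub>1 K) = file_size_defect C\<^sub>1 x"
      using file_size_defect_attained[OF C(1)] C(2) xy(2) by metis
    obtain L where L: "L \<subseteq> blocks C\<^sub>2" "card L = y" "card (missed C\<^sub>2 L) = file_size_defect C\<^sub>2 y"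
      using file_size_defect_attained[OF D(1)] D(2) xy(3) by metis
    have "finite K" "finite L" using K(1) L(1) C(3) D(3) by (auto intro: finite_subset)
    then have "card (K <+> L) = k" using K(2) L(2) xy(4) by (simp add: card_Plus)
    moreover have "K <+> L \<subseteq> blocks ?T" using K(1) L(1) blocks by auto
    ultimately show ?thesis
      using card_missed_le_file_size_defect[OF T] K(3) L(3) xy(1)
      by (metis missed_tensor card_cartesian_product)
  qed
  \<comment> \<open>Conversely, take \<open>k\<close> blocks of the product that miss as many points
    as possible and sort them by the factor they come from.\<close>
  have "k \<le> card (blocks ?T)"
    using assms(4) C D blocks by (simp add: card_Plus)
  then obtain X where X: "X \<subseteq> blocks ?T" "card X = k" "card (missed ?T X) = file_size_defect ?T k"
    using file_size_defect_attained[OF T] by metis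
  define K L where "K = Inl -` X" and "L = Inr -` X"
  have XKL: "X = K <+> L" using X(1) unfolding K_def L_def blocks by auto
  have sub: "K \<subseteq> blocks C\<^sub>1" "L \<subseteq> blocks C\<^sub>2" using X(1) unfolding K_def L_def blocks by auto
  have fin: "finite K" "finite L" using sub C(3) D(3) by (auto intro: finite_subset)
  have "card K \<le> n\<^sub>1" "card L \<le> n\<^sub>2" using sub C D card_mono by metis+
  moreover have "card K + card L = k" using X(2) XKL fin by (simp add: card_Plus)
  ultimately have mem: "file_size_defect C\<^sub>1 (card K) * file_size_defect C\<^sub>2 (card L) \<in> ?S" by auto
  have "file_size_defect ?T k = card (missed C\<^sub>1 K) * card (missed C\<^sub>2 L)"
    using X(3) XKL by (simp add: missed_tensor card_cartesian_product)
  also have "\<dots> \<le> file_size_defect C\<^sub>1 (card K) * file_size_defect C\<^sub>2 (card L)"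
    by (intro mult_mono card_missed_le_file_size_defect C D sub) auto
  \<comment> \<open>Membership requires equality with some product in \<open>?S\<close>. The chain
    gives one inequality; its right-hand side lies in \<open>?S\<close>, so \<open>le\<close> gives
    the reverse one.\<close>
  finally show "file_size_defect ?T k \<in> ?S"
    using le[OF mem] mem by (metis (no_types, lifting) le_antisym)
qed

end
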